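(* Let $q\in\mathbb{C}$ with $\operatorname{Re} q>0$ and let $r>\frac{2}{\operatorname{Re} q}$. Every element $G_r$ of $\mathcal{J}_r$ can be extended as a univalent function to the disk $D_{\rho(r)}$, $\rho(r)=\left(\sqrt{2r\operatorname{Re} q}-\sqrt{r\operatorname{Re} q-1}\right)^2>1$, and satisfies: (a) $D_{\rho_1(r)}\supset G_r(D_{\rho(r)})\supset D_{\rho_2(r)}$ with $$\rho_1(r)=\sqrt{\frac{2r\operatorname{Re} q}{r\operatorname{Re} q-1}}-1,\qquad \rho_2(r)=\frac{\left(\sqrt{2r\operatorname{Re} q}-\sqrt{r\operatorname{Re} q-1}\right)^2}{|1+rq|+\sqrt{2+r\operatorname{Re} q+r^2|q|^2}};$$ (b) $G_r(\mathbb{D})\subset D_{\rho_3(r)}$, where $\rho_3(r)=\frac{3}{1+r\operatorname{Re} q}$. Furthermore, for any $r>0$ and every $G_r\in\mathcal{J}_r$, $G_r(\mathbb{D})\supset D_{\rho_4(r)}$, where $\rho_4(r)=\dfrac{1}{|1+rq|+\sqrt{|1+rq|^2-1}}$.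
   Context: $\mathbb{D}=\{z\in\mathbb{C}:|z|<1\}$ and $D_s=\{z\in\mathbb{C}:|z|<s\}$. A holomorphic function $f:\mathbb{D}\to\mathbb{C}$ is called a generator if for every $z\in\mathbb{D}$ the Cauchy problem $\frac{\partial u(t,z)}{\partial t}+f(u(t,z))=0$, $u(0,z)=z$, has a unique solution $u(t,z)\in\mathbb{D}$ defined for all $t\ge 0$. For a generator $f$ and $r>0$, it is known that $(\mathrm{Id}+rf)(\mathbb{D})\supset\mathbb{D}$ and that $G_r:=(\mathrm{Id}+rf)^{-1}$ is a well-defined holomorphic self-mapping of $\mathbb{D}$ (that is, $G_r(w)$ is the unique $z\in\mathbb{D}$ with $z+rf(z)=w$); it is called the nonlinear resolvent of $f$. For fixed $q\in\mathbb{C}$ with $\operatorname{Re} q>0$ and $r>0$, $\mathcal{J}_r$ denotes the family of all resolvents $G_r=(\mathrm{Id}+rf)^{-1}$ of generators $f$ with $f(0)=0$ and $f'(0)=q$. *)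

theory Defs
  imports "HOL-Analysis.Analysis"
begin

text \<open>Functions on the open unit disk \<^term>\<open>ball (0::complex) 1\<close> are total functions of which only
  the values on the disk are used; likewise a solution of the Cauchy problem is a total function of
  a real variable of which only the values at nonnegative times are used.  The derivative at time
  \<open>0\<close> is one-sided.\<close>

definition cauchy_solution :: "(complex \<Rightarrow> complex) \<Rightarrow> complex \<Rightarrow> (real \<Rightarrow> complex) \<Rightarrow> bool" where
  "cauchy_solution f z u \<longleftrightarrow>
     u 0 = z \<and>
     (\<forall>t\<ge>0. u t \<in> ball 0 1 \<and> (u has_vector_derivative - f (u t)) (at t within {0..}))"

definition generator :: "(complex \<Rightarrow> complex) \<Rightarrow> bool" where
  "generator f \<longleftrightarrow>
     f holomorphic_on ball 0 1 \<and>
     (\<forall>z\<in>ball 0 1.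
        (\<exists>u. cauchy_solution f z u) \<and>
        (\<forall>u v. cauchy_solution f z u \<longrightarrow> cauchy_solution f z v \<longrightarrow> (\<forall>t\<ge>0. u t = v t)))"

text \<open>For a generator \<open>f\<close>, \<open>r > 0\<close> and \<open>w\<close> in the unit disk the described point exists and is
  unique; at other \<open>w\<close> the value is irrelevant.\<close>

definition nonlinear_resolvent :: "(complex \<Rightarrow> complex) \<Rightarrow> real \<Rightarrow> complex \<Rightarrow> complex" where
  "nonlinear_resolvent f r w = (THE z. z \<in> ball 0 1 \<and> z + of_real r * f z = w)"

definition resolvent_family :: "complex \<Rightarrow> real \<Rightarrow> (complex \<Rightarrow> complex) set" where
  "resolvent_family q r =
     {nonlinear_resolvent f r | f. generator f \<and> f 0 = 0 \<and> deriv f 0 = q}"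

definition univalent_on :: "(complex \<Rightarrow> complex) \<Rightarrow> complex set \<Rightarrow> bool" where
  "univalent_on F S \<longleftrightarrow> F holomorphic_on S \<and> inj_on F S"

definition rho :: "complex \<Rightarrow> real \<Rightarrow> real" where
  "rho q r = (sqrt (2 * r * Re q) - sqrt (r * Re q - 1))\<^sup>2"

definition rho1 :: "complex \<Rightarrow> real \<Rightarrow> real" where
  "rho1 q r = sqrt (2 * r * Re q / (r * Re q - 1)) - 1"

definition rho2 :: "complex \<Rightarrow> real \<Rightarrow> real" where
  "rho2 q r = (sqrt (2 * r * Re q) - sqrt (r * Re q - 1))\<^sup>2 /
     (cmod (1 + of_real r * q) + sqrt (2 + r * Re q + r\<^sup>2 * (cmod q)\<^sup>2))"

definition rho3 :: "complex \<Rightarrow> real \<Rightarrow> real" where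
  "rho3 q r = 3 / (1 + r * Re q)"

definition rho4 :: "complex \<Rightarrow> real \<Rightarrow> real" where
  "rho4 q r = 1 /
     (cmod (1 + of_real r * q) + sqrt ((cmod (1 + of_real r * q))\<^sup>2 - 1))"

end

theory Submission
  imports Defs "HOL-Complex_Analysis.Complex_Analysis"
begin

text \<open>
The resolvent inverts \<open>g z = z + r f z\<close>, so every claim is a growth estimate for \<open>g\<close>.

Holomorphic dependence of the Cauchy problem on its initial value (\<open>flow_holomorphic\<close>) and Schwarz's
lemma show that the flow of a generator with \<open>f 0 = 0\<close> does not increase \<open>|z|\<close>; infinitesimally,
\<open>Re (cnj z * f z) \<ge> 0\<close> (\<open>generator_dissipative\<close>).  Hence \<open>f z = z p z\<close> with \<open>Re p \<ge> 0\<close> and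
\<open>p 0 = q\<close>, so \<open>g z = z P z\<close> with \<open>P = 1 + r p\<close>.  With \<open>a = r Re q\<close> and \<open>x = |1 + r q|\<close>, Schwarz's
lemma in the half-plane (\<open>halfplane_schwarz\<close>) gives, for \<open>|z| = s < 1\<close>,

  \<open>1 + a (1 - s) / (1 + s) \<le> |P z| \<le> x + 2 a s / (1 - s)\<close>.

The lower bound for \<open>|g z|\<close>, that is \<open>h s = s (1 + a (1 - s) / (1 + s))\<close>, exceeds \<open>|w|\<close> near the unit
circle if \<open>|w| < 1\<close>, so by Rouche's theorem \<open>g z = w\<close> has exactly one solution in the disk.  For
\<open>a > 2\<close> the function \<open>h\<close> has an interior maximum: it is attained at \<open>s = \<rho>\<^sub>1\<close>, and its value is \<open>\<rho>\<close>.
The same argument on the circle \<open>|z| = \<rho>\<^sub>1\<close> shows that \<open>g\<close> maps a subdomain of the disk of radius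
\<open>\<rho>\<^sub>1\<close> bijectively onto the disk of radius \<open>\<rho>\<close>; the inverse is the univalent extension
(\<open>resolvent_extension\<close>).  Moreover \<open>h s < 1\<close> forces \<open>s < 1 / (a - 1) < \<rho>\<^sub>3\<close>.

A disk is covered by the image of the resolvent as soon as \<open>g\<close> maps it into the disk of definition,
so \<open>\<rho>\<^sub>2\<close> and \<open>\<rho>\<^sub>4\<close> come from the upper bound \<open>|g z| \<le> s (x + 2 a s / (1 - s))\<close>, which is below \<open>\<rho>\<close>
for \<open>s < \<rho>\<^sub>2\<close> and below \<open>1\<close> for \<open>s < \<rho>\<^sub>4\<close>.\<close>

section \<open>Holomorphic dependence of the flow on the initial value\<close>

text \<open>The squared norm \<open>|d|\<^sup>2\<close> grows at most at rate \<open>2 L |d|\<^sup>2\<close>, so multiplying it by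
  \<open>exp (- 2 L s)\<close> makes it decrease.\<close>

lemma gronwall_norm:
  fixes d :: "real \<Rightarrow> complex"
  assumes t: "t \<ge> 0"
    and der: "\<And>s. 0 \<le> s \<Longrightarrow> s \<le> t \<Longrightarrow> (d has_vector_derivative d' s) (at s within {0..})"
    and bound: "\<And>s. 0 < s \<Longrightarrow> s < t \<Longrightarrow> norm (d' s) \<le> L * norm (d s)"
  shows "norm (d t) \<le> norm (d 0) * exp (L * t)"
proof -
  define \<psi> where "\<psi> s = (d s \<bullet> d s) * exp (- 2 * L * s)" for s
  have cont_d: "continuous_on {0..t} d"
    unfolding continuous_on_eq_continuous_within
    by (meson atLeastAtMost_iff atLeast_iff continuous_within_subset der
        has_vector_derivative_continuous subsetI)
  have "\<psi> t \<le> \<psi> 0"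
  proof (rule DERIV_nonpos_imp_decreasing_open [OF t])
    show "continuous_on {0..t} \<psi>"
      unfolding \<psi>_def by (intro continuous_intros cont_d)
    fix s assume s: "0 < s" "s < t"
    have "at s within {0..} = at s"
      using s by (intro at_within_interior) auto
    then have "(d has_vector_derivative d' s) (at s)"
      using der[of s] s by auto
    then have dd: "(d has_derivative (\<lambda>h. h *\<^sub>R d' s)) (at s)"
      by (simp add: has_vector_derivative_def)
    have "((\<lambda>s. d s \<bullet> d s) has_real_derivative 2 * (d s \<bullet> d' s)) (at s)"
      unfolding has_field_derivative_def
      by (rule derivative_eq_intros dd)+ (auto simp: fun_eq_iff inner_commute)
    then have D: "(\<psi> has_real_derivative 2 * (d s \<bullet> d' s - L * (d s \<bullet> d s)) * exp (- 2 * L * s)) (at s)"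
      unfolding \<psi>_def by (auto intro!: derivative_eq_intros simp: algebra_simps)
    have "d s \<bullet> d' s \<le> norm (d s) * norm (d' s)"
      by (rule norm_cauchy_schwarz)
    also have "\<dots> \<le> norm (d s) * (L * norm (d s))"
      using bound[OF s] by (intro mult_left_mono) auto
    also have "\<dots> = L * (d s \<bullet> d s)"
      by (simp add: dot_square_norm power2_eq_square)
    finally have "2 * (d s \<bullet> d' s - L * (d s \<bullet> d s)) * exp (- 2 * L * s) \<le> 0"
      by (simp add: mult_le_0_iff)
    with D show "\<exists>y. DERIV \<psi> s :> y \<and> y \<le> 0" by blast
  qed
  then have "(norm (d t))\<^sup>2 * exp (- 2 * L * t) * exp (2 * L * t) \<le> (norm (d 0))\<^sup>2 * exp (2 * L * t)"
    unfolding \<psi>_def dot_square_norm by (intro mult_right_mono) auto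
  also have "(norm (d t))\<^sup>2 * exp (- 2 * L * t) * exp (2 * L * t) = (norm (d t))\<^sup>2"
    by (simp add: mult.assoc flip: exp_add)
  also have "(norm (d 0))\<^sup>2 * exp (2 * L * t) = (norm (d 0) * exp (L * t))\<^sup>2"
    by (simp add: power_mult_distrib mult.assoc flip: exp_of_nat_mult)
  finally show ?thesis
    by (rule power2_le_imp_le) simp
qed

lemma cauchy_solution_continuous:
  assumes "cauchy_solution f z u"
  shows "continuous_on {0..t} u"
  unfolding continuous_on_eq_continuous_within
  by (meson assms atLeastAtMost_iff atLeast_iff cauchy_solution_def continuous_within_subset
      has_vector_derivative_continuous subsetI)

text \<open>Lipschitz control of \<open>f\<close> is available only on the smaller disk of radius \<open>R'\<close>, so Gronwall's bound
  applies to \<open>u\<close> only as long as \<open>u\<close> stays in that disk.  At a first exit time the bound still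
  holds and puts \<open>u\<close> within \<open>R' - R\<close> of \<open>v\<close>, hence strictly inside; so there is no exit time.\<close>

lemma cauchy_solutions_stay_close:
  assumes holf: "f holomorphic_on ball 0 1"
    and u: "cauchy_solution f z u" and v: "cauchy_solution f w v"
    and v_le: "\<And>s. 0 \<le> s \<Longrightarrow> s \<le> t \<Longrightarrow> norm (v s) \<le> R"
    and R': "R' < 1"
    and L: "L \<ge> 0" "\<And>x. x \<in> cball 0 R' \<Longrightarrow> norm (deriv f x) \<le> L"
    and close: "norm (z - w) * exp (L * t) < R' - R"
    and s: "0 \<le> s" "s \<le> t"
  shows "norm (u s) < R'" "norm (u s - v s) \<le> norm (z - w) * exp (L * t)"
proof -
  have lip: "norm (f x - f y) \<le> L * norm (x - y)" if "x \<in> cball 0 R'" "y \<in> cball 0 R'" for x y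
  proof (rule field_differentiable_bound [OF convex_cball _ L(2) that])
    fix x :: complex assume "x \<in> cball 0 R'"
    then show "(f has_field_derivative deriv f x) (at x within cball 0 R')"
      using R' by (intro has_field_derivative_at_within [OF holomorphic_derivI [OF holf open_ball]]) auto
  qed
  have R_R': "R < R'"
    using close by (smt (verit) exp_gt_zero mult_nonneg_nonneg norm_ge_zero)
  have bound: "norm (u s - v s) \<le> norm (z - w) * exp (L * t)"
    if s: "0 \<le> s" "s \<le> t" and in_disk: "\<And>x. 0 < x \<Longrightarrow> x < s \<Longrightarrow> norm (u x) \<le> R'" for s
  proof -
    have "norm (u s - v s) \<le> norm (u 0 - v 0) * exp (L * s)"
    proof (rule gronwall_norm [where d = "\<lambda>s. u s - v s" and d' = "\<lambda>s. - f (u s) - (- f (v s))"])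
      fix x assume "0 \<le> x" "x \<le> s"
      then show "((\<lambda>s. u s - v s) has_vector_derivative - f (u x) - (- f (v x))) (at x within {0..})"
        using u v by (intro has_vector_derivative_diff) (auto simp: cauchy_solution_def)
    next
      fix x assume x: "0 < x" "x < s"
      then have "norm (v x) \<le> R"
        using s by (intro v_le) auto
      then have "norm (f (u x) - f (v x)) \<le> L * norm (u x - v x)"
        using R_R' in_disk[OF x] by (intro lip) auto
      then show "norm (- f (u x) - - f (v x)) \<le> L * norm (u x - v x)"
        by (simp add: norm_minus_commute)
    qed (use s in auto)
    also have "u 0 - v 0 = z - w"
      using u v by (simp add: cauchy_solution_def)
    also have "norm (z - w) * exp (L * s) \<le> norm (z - w) * exp (L * t)"
      using L s by (auto intro!: mult_left_mono)
    finally show ?thesis .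
  qed
  have inside: "norm (u s) < R'" if s: "0 \<le> s" "s \<le> t" for s
  proof (rule ccontr)
    assume "\<not> norm (u s) < R'"
    \<comment> \<open>\<open>X\<close> is the set of times outside the disk; its minimum is the first exit time.\<close>
    define X where "X = {x \<in> {0..t}. R' \<le> norm (u x)}"
    have "s \<in> X" using \<open>\<not> norm (u s) < R'\<close> s by (auto simp: X_def)
    have "closed X"
      unfolding X_def
      by (intro continuous_on_closed_Collect_le continuous_intros cauchy_solution_continuous [OF u])
    have "compact X"
      using compact_Int_closed [OF compact_Icc [of 0 t] \<open>closed X\<close>]
      by (rule back_subst [of compact]) (auto simp: X_def)
    then obtain x where x: "x \<in> X" and x_min: "\<And>y. y \<in> X \<Longrightarrow> x \<le> y"
      using compact_attains_inf \<open>s \<in> X\<close> by (metis empty_iff)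
    have x': "0 \<le> x" "x \<le> t" using x by (auto simp: X_def)
    have "norm (u y) \<le> R'" if "0 < y" "y < x" for y
      using x_min[of y] that x' by (force simp: X_def)
    then have "norm (u x - v x) < R' - R"
      using bound[OF x'] close by auto
    moreover have "norm (v x) \<le> R" by (rule v_le [OF x'])
    ultimately have "norm (u x) < R'"
      using norm_triangle_sub [of "u x" "v x"] by linarith
    with x show False by (simp add: X_def)
  qed
  show "norm (u s) < R'" by (rule inside [OF s])
  show "norm (u s - v s) \<le> norm (z - w) * exp (L * t)"
    using s by (intro bound less_imp_le [OF inside]) auto
qed

lemma has_field_derivative_quadratic_error:
  fixes F :: "complex \<Rightarrow> complex"
  assumes "\<delta> > 0" and err: "\<And>z. norm (z - a) < \<delta> \<Longrightarrow> norm (F z - F a - D * (z - a)) \<le> C * (norm (z - a))\<^sup>2"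
  shows "(F has_field_derivative D) (at a)"
  unfolding has_field_derivative_def has_derivative_at_alt
proof (intro conjI allI impI)
  show "bounded_linear ((*) D)" by (rule bounded_linear_mult_right)
  fix e :: real assume "e > 0"
  define \<eta> where "\<eta> = min \<delta> (e / (\<bar>C\<bar> + 1))"
  have "\<eta> > 0" using \<open>e > 0\<close> \<open>\<delta> > 0\<close> by (simp add: \<eta>_def)
  moreover have "norm (F z - F a - D * (z - a)) \<le> e * norm (z - a)" if "norm (z - a) < \<eta>" for z
  proof -
    have "C * norm (z - a) \<le> (\<bar>C\<bar> + 1) * norm (z - a)"
      by (intro mult_right_mono) auto
    also have "\<dots> \<le> e"
      using that by (simp add: \<eta>_def field_simps)
    finally have "C * norm (z - a) * norm (z - a) \<le> e * norm (z - a)"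
      by (intro mult_right_mono) auto
    with err[of z] that show ?thesis
      by (simp add: \<eta>_def power2_eq_square mult.assoc)
  qed
  ultimately show "\<exists>d>0. \<forall>y. norm (y - a) < d \<longrightarrow> norm (F y - F a - D * (y - a)) \<le> e * norm (y - a)"
    by blast
qed

text \<open>Write \<open>v\<close> for the solution from \<open>a\<close> and \<open>E s = exp (\<integral>\<^sub>0\<^sup>s f' (v))\<close>; then \<open>1 / E\<close> solves the equation
  \<open>y' = - f' (v) y\<close> obtained by linearising along \<open>v\<close>.  The difference \<open>d\<close> of the solutions from \<open>z\<close>
  and \<open>a\<close> satisfies this linear equation up to an error \<open>O (|d|\<^sup>2) = O (|z - a|\<^sup>2)\<close>, so \<open>d E\<close> stays within
  \<open>O (|z - a|\<^sup>2)\<close> of its initial value \<open>z - a\<close>.  Hence the flow has the complex derivative \<open>1 / E t\<close>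
  at \<open>a\<close>.\<close>

lemma flow_holomorphic:
  assumes holf: "f holomorphic_on ball 0 1"
    and u: "\<And>z. z \<in> ball 0 1 \<Longrightarrow> cauchy_solution f z (u z)"
    and t: "t > 0"
  shows "(\<lambda>z. u z t) holomorphic_on ball 0 1"
proof -
  have "\<exists>D. ((\<lambda>z. u z t) has_field_derivative D) (at a)" if a: "a \<in> ball 0 1" for a
  proof -
    let ?v = "u a"
    note v = u [OF a]
    have contv: "continuous_on {0..t} ?v" by (rule cauchy_solution_continuous [OF v])
    obtain m where m: "m \<in> {0..t}" "\<And>s. s \<in> {0..t} \<Longrightarrow> norm (?v s) \<le> norm (?v m)"
      using continuous_attains_sup [of "{0..t}" "\<lambda>s. norm (?v s)"] continuous_on_norm [OF contv] t
      by fastforce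
    define R where "R = norm (?v m)"
    define R' where "R' = (1 + R) / 2"
    have "R < 1" using v m by (auto simp: R_def cauchy_solution_def)
    have R': "R < R'" "R' < 1" using \<open>R < 1\<close> by (auto simp: R'_def)
    have sub: "cball 0 R' \<subseteq> (ball 0 1 :: complex set)" using R' by auto
    have v_le: "norm (?v s) \<le> R" if "0 \<le> s" "s \<le> t" for s
      using m that by (auto simp: R_def)
    have holf': "deriv f holomorphic_on ball 0 1" "deriv (deriv f) holomorphic_on ball 0 1"
      by (auto intro!: holomorphic_deriv holf)
    have bdd: "\<exists>B\<ge>0. \<forall>x\<in>cball 0 R'. norm (h x) \<le> B" if "h holomorphic_on ball 0 1" for h :: "complex \<Rightarrow> complex"
    proof -
      have "compact (h ` cball 0 R')"
        using that sub by (intro compact_continuous_image holomorphic_on_imp_continuous_on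
            holomorphic_on_subset [OF that]) auto
      then obtain B where "\<forall>x\<in>h ` cball 0 R'. norm x \<le> B"
        using compact_imp_bounded bounded_iff by metis
      then show ?thesis
        by (intro exI [of _ "\<bar>B\<bar>"]) (auto intro: order_trans [OF _ abs_ge_self])
    qed
    obtain L where L: "L \<ge> 0" "\<And>x. x \<in> cball 0 R' \<Longrightarrow> norm (deriv f x) \<le> L"
      using bdd [OF holf'(1)] by metis
    obtain B where B: "B \<ge> 0" "\<And>x. x \<in> cball 0 R' \<Longrightarrow> norm (deriv (deriv f) x) \<le> B"
      using bdd [OF holf'(2)] by metis
    have taylor: "norm (f x - f y - deriv f y * (x - y)) \<le> B * (norm (x - y))\<^sup>2"
      if xy: "x \<in> cball 0 R'" "y \<in> cball 0 R'" for x y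
    proof -
      define F where "F i = (deriv ^^ i) f" for i
      have "norm (F 0 x - (\<Sum>i\<le>1. F i y * (x - y) ^ i / fact i)) \<le> B * norm (x - y) ^ Suc 1 / fact 1"
      proof (rule complex_Taylor [OF convex_cball _ _ xy(2,1)])
        fix i x assume "x \<in> cball (0::complex) R'" "i \<le> (1::nat)"
        then show "(F i has_field_derivative F (Suc i) x) (at x within cball 0 R')"
          using sub holomorphic_derivI [OF holomorphic_higher_deriv [OF holf open_ball] open_ball, of x i]
          by (auto simp: F_def intro: has_field_derivative_at_within)
      next
        fix x assume "x \<in> cball (0::complex) R'"
        then show "norm (F (Suc 1) x) \<le> B" using B by (simp add: F_def)
      qed
      then show ?thesis by (simp add: F_def power2_eq_square algebra_simps)
    qed
    have contdv: "continuous_on {0..t} (\<lambda>s. deriv f (?v s))"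
      by (rule continuous_on_compose2 [OF holomorphic_on_imp_continuous_on [OF holf'(1)] contv])
        (use v in \<open>auto simp: cauchy_solution_def\<close>)
    define I where "I s = integral {0..s} (\<lambda>s. deriv f (?v s))" for s
    define E where "E s = exp (I s)" for s
    have derI: "(I has_vector_derivative deriv f (?v s)) (at s within {0..t})" if "s \<in> {0..t}" for s
      unfolding I_def by (rule integral_has_vector_derivative [OF contdv that])
    have contE: "continuous_on {0..t} E"
      unfolding E_def
      using has_vector_derivative_continuous [OF derI]
      by (intro continuous_on_exp) (simp add: continuous_on_eq_continuous_within)
    obtain M where M: "\<And>s. s \<in> {0..t} \<Longrightarrow> norm (E s) \<le> M" "M \<ge> 0"
    proof -
      have "bounded (E ` {0..t})"
        by (intro compact_imp_bounded compact_continuous_image contE) auto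
      then obtain M where "\<forall>x\<in>E ` {0..t}. norm x \<le> M" by (auto simp: bounded_iff)
      moreover from this have "norm (E 0) \<le> M" using t by simp
      then have "M \<ge> 0" by (rule order_trans [OF norm_ge_zero])
      ultimately show ?thesis by (intro that [of M]) auto
    qed
    define K where "K = exp (L * t)"
    define \<delta> where "\<delta> = min (1 - norm a) ((R' - R) / K)"
    have "K > 0" by (simp add: K_def)
    have "\<delta> > 0" using a R' \<open>K > 0\<close> by (simp add: \<delta>_def)
    moreover have "norm (u z t - u a t - inverse (E t) * (z - a)) \<le> (norm (inverse (E t)) * t * M * B * K\<^sup>2) * (norm (z - a))\<^sup>2"
      if z: "norm (z - a) < \<delta>" for z
    proof -
      have "z \<in> ball 0 1"
        using z norm_triangle_sub [of z a] by (auto simp: \<delta>_def)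
      note uz = u [OF this]
      have close: "norm (z - a) * exp (L * t) < R' - R"
        using z \<open>K > 0\<close> by (simp add: \<delta>_def K_def field_simps)
      note near = cauchy_solutions_stay_close [OF holf uz v v_le R'(2) L close, folded K_def]
      define d where "d s = u z s - ?v s" for s
      have "\<exists>x\<in>{0<..<t}. norm (d t * E t - d 0 * E 0) \<le>
              norm ((t - 0) *\<^sub>R (d x * (deriv f (?v x) * E x) + (- f (u z x) - - f (?v x)) * E x))"
      proof (rule mvt_general [OF t])
        show "continuous_on {0..t} (\<lambda>s. d s * E s)"
          unfolding d_def by (intro continuous_intros contE contv cauchy_solution_continuous [OF uz])
        fix x assume x: "0 < x" "x < t"
        have at1: "at x within {0..} = at x" and at2: "at x within {0..t} = at x"
          using x by (auto intro!: at_within_interior)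
        have 1: "(d has_vector_derivative - f (u z x) - - f (?v x)) (at x)"
          unfolding d_def
        proof (rule has_vector_derivative_diff)
          show "(u z has_vector_derivative - f (u z x)) (at x)"
            using uz x at1 unfolding cauchy_solution_def by (metis less_imp_le)
          show "(?v has_vector_derivative - f (?v x)) (at x)"
            using v x at1 unfolding cauchy_solution_def by (metis less_imp_le)
        qed
        have "(I has_vector_derivative deriv f (?v x)) (at x)"
          using derI[of x] x at2 by auto
        then have 2: "(E has_vector_derivative deriv f (?v x) * E x) (at x)"
          unfolding E_def using field_vector_diff_chain_at [of I _ x exp "exp (I x)"]
          by (auto simp: o_def intro: DERIV_exp)
        show "((\<lambda>s. d s * E s) has_derivative
            (\<lambda>h. h *\<^sub>R (d x * (deriv f (?v x) * E x) + (- f (u z x) - - f (?v x)) * E x))) (at x)"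
          using has_vector_derivative_mult [OF 1 2] by (simp add: has_vector_derivative_def)
      qed
      then obtain x where x: "0 < x" "x < t"
        and le: "norm (d t * E t - d 0 * E 0) \<le>
              norm (t *\<^sub>R (d x * (deriv f (?v x) * E x) + (- f (u z x) - - f (?v x)) * E x))"
        by auto
      have "norm (d x * (deriv f (?v x) * E x) + (- f (u z x) - - f (?v x)) * E x)
          = norm (E x) * norm (f (u z x) - f (?v x) - deriv f (?v x) * (u z x - ?v x))"
        unfolding d_def norm_mult [symmetric] by (subst norm_minus_cancel [symmetric]) (simp add: algebra_simps)
      also have "\<dots> \<le> M * (B * (norm (u z x - ?v x))\<^sup>2)"
        using x near(1)[of x] v_le[of x] R' M B by (intro mult_mono taylor) auto
      also have "\<dots> \<le> M * (B * (norm (z - a) * K)\<^sup>2)"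
        using x near(2)[of x] M B by (intro mult_left_mono power_mono) auto
      finally have *: "norm (d t * E t - d 0 * E 0) \<le> t * (M * (B * (norm (z - a) * K)\<^sup>2))"
        using le t by (simp add: order_trans [OF le] mult_left_mono)
      have "d 0 * E 0 = z - a"
        using uz v by (simp add: d_def E_def I_def cauchy_solution_def)
      then have "u z t - u a t - inverse (E t) * (z - a) = inverse (E t) * (d t * E t - d 0 * E 0)"
        by (simp add: E_def d_def field_simps)
      then have "norm (u z t - u a t - inverse (E t) * (z - a)) = norm (inverse (E t)) * norm (d t * E t - d 0 * E 0)"
        by (simp add: norm_mult)
      also have "\<dots> \<le> norm (inverse (E t)) * (t * (M * (B * (norm (z - a) * K)\<^sup>2)))"
        by (intro mult_left_mono *) auto
      finally show ?thesis by (simp add: power_mult_distrib mult_ac)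
    qed
    ultimately show ?thesis
      by (intro exI has_field_derivative_quadratic_error)
  qed
  then show ?thesis
    by (intro holomorphic_onI) (meson field_differentiable_at_within field_differentiable_def)
qed

text \<open>The time-\<open>t\<close> map of the flow is a holomorphic self-map of the disk fixing \<open>0\<close>, so Schwarz's lemma
  says that the flow never increases \<open>|z|\<close>; the claim is the sign of the derivative of \<open>|u|\<^sup>2\<close> at
  time \<open>0\<close>.\<close>

lemma generator_dissipative:
  assumes gen: "generator f" and f0: "f 0 = 0" and z: "z \<in> ball 0 1"
  shows "Re (cnj z * f z) \<ge> 0"
proof -
  have holf: "f holomorphic_on ball 0 1" using gen by (simp add: generator_def)
  obtain u where u: "\<And>z. z \<in> ball 0 1 \<Longrightarrow> cauchy_solution f z (u z)"
    using gen unfolding generator_def by metis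
  have "cauchy_solution f 0 (\<lambda>_. 0)"
    using f0 by (auto simp: cauchy_solution_def)
  then have u0: "u 0 t = 0" if "t \<ge> 0" for t
    using gen u[of 0] that unfolding generator_def by (metis centre_in_ball zero_less_one)
  have contract: "norm (u z t) \<le> norm z" if "t > 0" for t
  proof (rule Schwarz_Lemma(1) [of "\<lambda>z. u z t"])
    show "(\<lambda>z. u z t) holomorphic_on ball 0 1"
      by (rule flow_holomorphic [OF holf u that])
    show "norm (u x t) < 1" if "norm x < 1" for x
      using u[of x] that \<open>t > 0\<close> by (auto simp: cauchy_solution_def)
  qed (use u0 that z in auto)
  show ?thesis
  proof (rule ccontr)
    assume neg: "\<not> Re (cnj z * f z) \<ge> 0"
    have uz: "u z 0 = z" "(u z has_vector_derivative - f z) (at 0 within {0..})"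
      using u[OF z] by (auto simp: cauchy_solution_def)
    then have "(u z has_derivative (\<lambda>h. h *\<^sub>R (- f z))) (at 0 within {0..})"
      by (simp add: has_vector_derivative_def)
    then have "((\<lambda>s. u z s \<bullet> u z s) has_real_derivative - 2 * Re (cnj z * f z)) (at 0 within {0..})"
      unfolding has_field_derivative_def
      by (rule derivative_eq_intros | assumption)+ (auto simp: fun_eq_iff uz inner_complex_def algebra_simps)
    from has_real_derivative_pos_inc_right [OF this] neg
    obtain d where d: "d > 0" "\<And>h. 0 < h \<Longrightarrow> h < d \<Longrightarrow> u z 0 \<bullet> u z 0 < u z h \<bullet> u z h"
      by auto
    have "(norm z)\<^sup>2 < (norm (u z (d/2)))\<^sup>2"
      using d(2)[of "d/2"] d(1) uz by (simp add: dot_square_norm)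
    then have "norm z < norm (u z (d/2))"
      by (rule power2_less_imp_less) simp
    with contract[of "d/2"] d(1) show False by simp
  qed
qed

section \<open>Schwarz estimates in the half-plane\<close>

text \<open>If the real part vanished somewhere, \<open>exp (- p)\<close> would attain its maximum modulus there and \<open>p\<close>
  would have constant real part.\<close>

lemma Re_pos_of_Re_nonneg:
  assumes holp: "p holomorphic_on ball 0 1"
    and Re_p: "\<And>z. z \<in> ball 0 1 \<Longrightarrow> 0 \<le> Re (p z)"
    and Re_p0: "0 < Re (p 0)" and z: "z \<in> ball 0 1"
  shows "0 < Re (p z)"
proof (rule ccontr)
  assume "\<not> 0 < Re (p z)"
  then have "Re (p z) = 0" using Re_p[OF z] by simp
  have "(\<lambda>w. exp (- p w)) constant_on ball 0 1"
  proof (rule maximum_modulus_principle [where U = "ball 0 1" and \<xi> = z])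
    show "(\<lambda>w. exp (- p w)) holomorphic_on ball 0 1"
      by (intro holomorphic_intros holp)
    show "norm (exp (- p w)) \<le> norm (exp (- p z))" if "w \<in> ball 0 1" for w
      using Re_p[OF that] \<open>Re (p z) = 0\<close> by simp
  qed (use z in auto)
  then have "exp (- p 0) = exp (- p z)"
    using z unfolding constant_on_def by (metis centre_in_ball zero_less_one)
  then have "norm (exp (- p 0)) = norm (exp (- p z))" by simp
  then show False
    using Re_p0 \<open>Re (p z) = 0\<close> by simp
qed

text \<open>Both estimates are Schwarz's lemma for the Cayley transform \<open>\<omega> = (p - q) / (p + cnj q)\<close>, which
  vanishes at \<open>0\<close>.  The first follows from \<open>p - q = 2 Re q \<omega> / (1 - \<omega>)\<close>; the second, Harnack's
  inequality, from \<open>|p - q| \<le> |z| |p + cnj q|\<close>.\<close>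

lemma halfplane_schwarz:
  assumes holp: "p holomorphic_on ball 0 1"
    and Re_p: "\<And>z. z \<in> ball 0 1 \<Longrightarrow> 0 \<le> Re (p z)"
    and Re_p0: "0 < Re (p 0)" and z: "z \<in> ball 0 1"
  shows "norm (p z - p 0) \<le> 2 * Re (p 0) * norm z / (1 - norm z)"
    and "Re (p 0) * (1 - norm z) / (1 + norm z) \<le> Re (p z)"
proof -
  define q where "q = p 0"
  define \<omega> where "\<omega> w = (p w - q) / (p w + cnj q)" for w
  define s where "s = norm z"
  have s: "0 \<le> s" "s < 1" using z by (auto simp: s_def)
  have pos: "0 < Re (p w)" if "w \<in> ball 0 1" for w
    by (rule Re_pos_of_Re_nonneg [OF holp Re_p Re_p0 that])
  have q: "0 < Re q" using Re_p0 by (simp add: q_def)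
  have nz: "p w + cnj q \<noteq> 0" if "w \<in> ball 0 1" for w
    using pos[OF that] q by (auto simp: complex_eq_iff)
  have sq: "(norm (p w - q))\<^sup>2 = (norm (p w + cnj q))\<^sup>2 - 4 * Re (p w) * Re q" for w
    unfolding cmod_power2 by (simp add: power2_eq_square algebra_simps)
  have "norm (\<omega> z) \<le> norm z"
  proof (rule Schwarz_Lemma(1) [of \<omega>])
    show "\<omega> holomorphic_on ball 0 1"
      unfolding \<omega>_def using nz by (intro holomorphic_intros holp) auto
    show "\<omega> 0 = 0" by (simp add: \<omega>_def q_def)
    show "norm (\<omega> w) < 1" if "norm w < 1" for w
    proof -
      have w: "w \<in> ball 0 1" using that by simp
      have "0 < 4 * Re (p w) * Re q"
        using pos[OF w] q by simp
      then have "(norm (p w - q))\<^sup>2 < (norm (p w + cnj q))\<^sup>2"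
        using sq[of w] by linarith
      then have "norm (p w - q) < norm (p w + cnj q)"
        by (rule power_less_imp_less_base) simp
      then show ?thesis using nz[OF w] by (simp add: \<omega>_def norm_divide)
    qed
  qed (use z in auto)
  then have om: "norm (\<omega> z) \<le> s" by (simp add: s_def)
  have "(p z - q) * (1 - \<omega> z) = 2 * Re q * \<omega> z"
  proof -
    have "q + cnj q = 2 * Re q" by (simp add: complex_add_cnj)
    then show ?thesis using nz[OF z] by (simp add: \<omega>_def field_simps)
  qed
  then have "norm ((p z - q) * (1 - \<omega> z)) = norm (of_real (2 * Re q) * \<omega> z)"
    by simp
  then have "norm (p z - q) * norm (1 - \<omega> z) = 2 * Re q * norm (\<omega> z)"
    using q by (simp add: norm_mult del: of_real_mult)
  moreover have "1 - s \<le> norm (1 - \<omega> z)"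
    using om norm_triangle_ineq2[of 1 "\<omega> z"] by simp
  then have "norm (p z - q) * (1 - s) \<le> norm (p z - q) * norm (1 - \<omega> z)"
    by (intro mult_left_mono) auto
  moreover have "2 * Re q * norm (\<omega> z) \<le> 2 * Re q * s"
    using om q by (intro mult_left_mono) auto
  ultimately have "norm (p z - q) * (1 - s) \<le> 2 * Re q * s" by linarith
  then show "norm (p z - p 0) \<le> 2 * Re (p 0) * norm z / (1 - norm z)"
    using s by (simp add: q_def s_def field_simps)
  define x where "x = Re (p z)"
  have "norm (p z - q) \<le> s * norm (p z + cnj q)"
    using om nz[OF z] by (simp add: \<omega>_def norm_divide field_simps)
  then have "(norm (p z - q))\<^sup>2 \<le> s\<^sup>2 * (norm (p z + cnj q))\<^sup>2"
    by (metis norm_ge_zero power_mono power_mult_distrib)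
  then have "(1 - s\<^sup>2) * (norm (p z + cnj q))\<^sup>2 \<le> 4 * x * Re q"
    by (simp add: sq x_def algebra_simps)
  moreover have "(x + Re q)\<^sup>2 \<le> (norm (p z + cnj q))\<^sup>2"
    by (simp add: cmod_power2 x_def)
  then have "(1 - s\<^sup>2) * (x + Re q)\<^sup>2 \<le> (1 - s\<^sup>2) * (norm (p z + cnj q))\<^sup>2"
    using s by (intro mult_left_mono) (auto simp: power_le_one)
  ultimately have "(1 - s\<^sup>2) * (x + Re q)\<^sup>2 \<le> 4 * x * Re q" by linarith
  \<comment> \<open>The quadratic inequality for \<open>x\<close> factors, with the two Harnack bounds as roots.\<close>
  then have prod: "(Re q * (1 - s) - x * (1 + s)) * (Re q * (1 + s) - x * (1 - s)) \<le> 0"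
    by (simp add: power2_eq_square algebra_simps)
  have "Re q * (1 - s) \<le> x * (1 + s)"
  proof (rule ccontr)
    assume "\<not> ?thesis"
    moreover have "0 \<le> x * s" "0 \<le> Re q * s" using pos[OF z] q s by (auto simp: x_def)
    ultimately have "0 < Re q * (1 - s) - x * (1 + s)" "0 < Re q * (1 + s) - x * (1 - s)"
      by (auto simp: algebra_simps)
    then show False using prod mult_pos_pos by (meson not_less)
  qed
  then have "Re q * (1 - s) / (1 + s) \<le> x"
    using s by (simp add: pos_divide_le_eq)
  then show "Re (p 0) * (1 - norm z) / (1 + norm z) \<le> Re (p z)"
    by (simp add: q_def s_def x_def)
qed

section \<open>Solving the resolvent equation\<close>

text \<open>On the circle of radius \<open>R\<close> the constant \<open>w\<close> is dominated by \<open>z P z\<close>, so by Rouche's theorem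
  \<open>z P z - w\<close> has as many zeros in the disk as \<open>z P z\<close>, namely one: the factor
  \<open>P\<close> has none, and \<open>0\<close> is a simple zero.\<close>

lemma unique_preimage_in_disk:
  assumes holP: "P holomorphic_on ball 0 B" and nz: "\<And>z. z \<in> ball 0 B \<Longrightarrow> P z \<noteq> 0"
    and R: "0 < R" "R < B"
    and dom: "\<And>z. norm z = R \<Longrightarrow> norm w < norm (z * P z)"
  shows "\<exists>!z. z \<in> ball 0 R \<and> z * P z = w"
proof -
  \<comment> \<open>An intermediate disk, whose closure is still in the domain, contains only finitely many zeros.\<close>
  define S where "S = ball (0::complex) ((R + B) / 2)"
  have sub: "S \<subseteq> ball 0 B" "cball 0 R \<subseteq> S" "closure S \<subseteq> ball 0 B"
    using R by (auto simp: S_def)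
  let ?g = "\<lambda>z. z * P z" and ?h = "\<lambda>z. - w"
  define Z where "Z = {z \<in> S. ?g z + - w = 0}"
  have holg: "?g holomorphic_on ball 0 B" by (intro holomorphic_intros holP)
  have holgw: "(\<lambda>z. ?g z + - w) holomorphic_on S"
    by (intro holomorphic_intros holomorphic_on_subset [OF holP sub(1)])
  have R_out: "?g (of_real R) \<noteq> w" using dom[of "of_real R"] R by auto
  have finZ: "finite Z"
  proof -
    have "finite {z \<in> closure S. ?g z - w = 0}"
    proof (rule holomorphic_compact_finite_zeros)
      show "(\<lambda>z. ?g z - w) holomorphic_on ball 0 B" by (intro holomorphic_intros holP)
      show "\<not> (\<lambda>z. ?g z - w) constant_on ball 0 B"
      proof
        assume "(\<lambda>z. ?g z - w) constant_on ball 0 B"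
        then have "?g 0 - w = ?g (of_real R) - w"
          using R unfolding constant_on_def by (smt (verit) centre_in_ball mem_ball_0 norm_of_real)
        then show False using dom[of "of_real R"] R nz[of "of_real R"] by auto
      qed
    qed (use sub in \<open>auto simp: S_def\<close>)
    then show ?thesis
      by (rule finite_subset [rotated]) (use closure_subset in \<open>auto simp: Z_def\<close>)
  qed
  have zeros: "{z \<in> S. ?g z = 0} = {0}"
    using nz sub R by (auto simp: S_def)
  have order0: "zorder ?g 0 = 1"
    by (rule zorder_eqI [of "ball 0 B" 0 P]) (use R holP nz in auto)
  have "(\<Sum>p\<in>Z. winding_number (circlepath 0 R) p * zorder (\<lambda>z. ?g z + - w) p)
      = (\<Sum>p\<in>{z \<in> S. ?g z = 0}. winding_number (circlepath 0 R) p * zorder ?g p)"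
    unfolding Z_def
  proof (rule Rouche_theorem)
    show "(\<lambda>z. z * P z) holomorphic_on S"
      by (rule holomorphic_on_subset [OF holg sub(1)])
    show "finite {z \<in> S. z * P z + - w = 0}" using finZ by (simp only: Z_def)
    show "finite {z \<in> S. z * P z = 0}" unfolding zeros by simp
    show "\<forall>z. z \<notin> S \<longrightarrow> winding_number (circlepath 0 R) z = 0"
      by (intro allI impI winding_number_zero_outside [of _ S]) (use sub R in \<open>auto simp: S_def\<close>)
    show "\<forall>z\<in>path_image (circlepath 0 R). norm (- w) < norm (z * P z)"
      using dom R by auto
    show "path_image (circlepath 0 R) \<subseteq> S" using sub R by auto
  qed (auto simp: S_def)
  also have "\<dots> = 1"
    unfolding zeros using R order0 by (simp add: winding_number_circlepath)
  also have "(\<Sum>p\<in>Z. winding_number (circlepath 0 R) p * zorder (\<lambda>z. ?g z + - w) p)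
      = (\<Sum>p\<in>Z \<inter> ball 0 R. winding_number (circlepath 0 R) p * zorder (\<lambda>z. ?g z + - w) p)"
  proof (rule sum.mono_neutral_right [OF finZ])
    show "\<forall>p\<in>Z - Z \<inter> ball 0 R. winding_number (circlepath 0 R) p * zorder (\<lambda>z. ?g z + - w) p = 0"
    proof
      fix p assume p: "p \<in> Z - Z \<inter> ball 0 R"
      then have "norm p \<noteq> R" using dom[of p] by (auto simp: Z_def)
      then have "winding_number (circlepath 0 R) p = 0"
        by (intro winding_number_zero_outside [of _ "cball 0 R"]) (use p R in auto)
      then show "winding_number (circlepath 0 R) p * zorder (\<lambda>z. ?g z + - w) p = 0" by simp
    qed
  qed auto
  also have "\<dots> = of_int (\<Sum>p\<in>Z \<inter> ball 0 R. zorder (\<lambda>z. ?g z + - w) p)"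
    unfolding of_int_sum by (intro sum.cong) (auto simp: winding_number_circlepath)
  finally have sum1: "(\<Sum>p\<in>Z \<inter> ball 0 R. zorder (\<lambda>z. ?g z + - w) p) = 1"
    by (metis of_int_eq_1_iff)
  have "zorder (\<lambda>z. ?g z + - w) p \<ge> 1" if "p \<in> Z" for p
  proof -
    have "\<exists>z\<in>S. ?g z + - w \<noteq> 0"
      using R_out sub R by (intro bexI [of _ "of_real R"]) auto
    then show ?thesis
      using zorder_exist_zero [of "\<lambda>z. ?g z + - w" S p] that holgw
      by (auto simp: Z_def S_def)
  qed
  then have "(\<Sum>p\<in>Z \<inter> ball 0 R. 1) \<le> (\<Sum>p\<in>Z \<inter> ball 0 R. zorder (\<lambda>z. ?g z + - w) p)"
    by (intro sum_mono) auto
  then have "card (Z \<inter> ball 0 R) \<le> 1" using sum1 by simp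
  moreover have "Z \<inter> ball 0 R \<noteq> {}" using sum1 by (intro notI) simp
  ultimately have "card (Z \<inter> ball 0 R) = 1"
    using finZ by (metis card_0_eq finite_Int le_antisym less_one not_less)
  then obtain z where "Z \<inter> ball 0 R = {z}" by (auto simp: card_1_singleton_iff)
  moreover have "Z \<inter> ball 0 R = {z. z \<in> ball 0 R \<and> z * P z = w}"
    using sub by (auto simp: Z_def)
  ultimately show ?thesis by (metis (mono_tags, lifting) mem_Collect_eq singleton_iff)
qed

text \<open>Since \<open>f 0 = 0\<close>, \<open>f z = z p z\<close>, and dissipativity says \<open>Re p \<ge> 0\<close>.  The factor of the resolvent
  equation is \<open>P = 1 + r p\<close>, and the half-plane estimates for \<open>p\<close> bound it from both sides.\<close>

lemma resolvent_equation_factor: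
  assumes gen: "generator f" and f0: "f 0 = 0" and q: "Re (deriv f 0) > 0" and r: "r > 0"
  obtains P where "P holomorphic_on ball 0 1"
    and "\<And>z. z \<in> ball 0 1 \<Longrightarrow> z + of_real r * f z = z * P z"
    and "\<And>z. z \<in> ball 0 1 \<Longrightarrow> 1 + r * Re (deriv f 0) * (1 - norm z) / (1 + norm z) \<le> norm (P z)"
    and "\<And>z. z \<in> ball 0 1 \<Longrightarrow>
           norm (P z) \<le> norm (1 + of_real r * deriv f 0) + 2 * (r * Re (deriv f 0)) * norm z / (1 - norm z)"
proof -
  have "f holomorphic_on ball 0 1" using gen by (simp add: generator_def)
  then obtain p where p: "p holomorphic_on ball 0 1" "\<And>z. norm z < 1 \<Longrightarrow> f z = z * p z" "deriv f 0 = p 0"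
    using Schwarz3 f0 by metis
  have Re_p: "0 \<le> Re (p z)" if z: "z \<in> ball 0 1" for z
  proof (cases "z = 0")
    case True
    then show ?thesis using q p by simp
  next
    case False
    have "cnj z * f z = of_real ((norm z)\<^sup>2) * p z"
      using p(2)[of z] z unfolding complex_norm_square by (simp add: mult_ac)
    then have "0 \<le> (norm z)\<^sup>2 * Re (p z)"
      using generator_dissipative [OF gen f0 z] by (simp del: of_real_power)
    then show ?thesis using False by (simp add: zero_le_mult_iff)
  qed
  have Re_p0: "0 < Re (p 0)" using q p by simp
  define P where "P z = 1 + of_real r * p z" for z
  show ?thesis
  proof
    show "P holomorphic_on ball 0 1"
      unfolding P_def by (intro holomorphic_intros p)
    fix z :: complex assume z: "z \<in> ball 0 1"
    show "z + of_real r * f z = z * P z"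
      using z p(2)[of z] by (simp add: P_def algebra_simps)
    note bounds = halfplane_schwarz [OF p(1) Re_p Re_p0 z]
    have "r * (Re (p 0) * (1 - norm z) / (1 + norm z)) \<le> r * Re (p z)"
      using bounds(2) r by (intro mult_left_mono) auto
    then have "1 + r * Re (deriv f 0) * (1 - norm z) / (1 + norm z) \<le> Re (P z)"
      by (simp add: P_def p mult.assoc)
    also have "\<dots> \<le> norm (P z)" by (rule complex_Re_le_cmod)
    finally show "1 + r * Re (deriv f 0) * (1 - norm z) / (1 + norm z) \<le> norm (P z)" .
    have "P z = (1 + of_real r * p 0) + of_real r * (p z - p 0)"
      by (simp add: P_def algebra_simps)
    then have "norm (P z) \<le> norm (1 + of_real r * p 0) + r * norm (p z - p 0)"
      using norm_triangle_ineq [of "1 + of_real r * p 0" "of_real r * (p z - p 0)"] r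
      by (simp add: norm_mult)
    also have "r * norm (p z - p 0) \<le> r * (2 * Re (p 0) * norm z / (1 - norm z))"
      using bounds(1) r by (intro mult_left_mono) auto
    finally show "norm (P z) \<le> norm (1 + of_real r * deriv f 0) + 2 * (r * Re (deriv f 0)) * norm z / (1 - norm z)"
      by (simp add: p mult_ac)
  qed
qed

text \<open>The circle of radius \<open>R\<close> dominates \<open>w\<close> as soon as \<open>|w| < R\<close>, because \<open>|z P z| \<ge> |z|\<close>; two
  preimages in the unit disk lie in a common smaller disk.\<close>

lemma unique_preimage_in_unit_disk:
  assumes holP: "P holomorphic_on ball 0 1" and P_ge: "\<And>z. z \<in> ball 0 1 \<Longrightarrow> 1 \<le> norm (P z)"
    and w: "w \<in> ball 0 1"
  shows "\<exists>!z. z \<in> ball 0 1 \<and> z * P z = w"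
proof -
  have unique: "\<exists>!z. z \<in> ball 0 R \<and> z * P z = w" if R: "norm w < R" "R < 1" for R
  proof (rule unique_preimage_in_disk [OF holP _ _ R(2)])
    show "0 < R" using R(1) norm_ge_zero [of w] by linarith
    show "P z \<noteq> 0" if "z \<in> ball 0 1" for z using P_ge[OF that] by auto
    show "norm w < norm (z * P z)" if "norm z = R" for z
    proof -
      have "norm z * 1 \<le> norm z * norm (P z)"
        using that R by (intro mult_left_mono P_ge) auto
      then show ?thesis using that R by (simp add: norm_mult)
    qed
  qed
  obtain R where R: "norm w < R" "R < 1" using w dense by auto
  obtain z where z: "z \<in> ball 0 R" "z * P z = w" using unique[OF R] by blast
  show ?thesis
  proof (rule ex1I [of _ z])
    show "z \<in> ball 0 1 \<and> z * P z = w" using z R by auto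
    fix y assume y: "y \<in> ball 0 1 \<and> y * P y = w"
    have "max R (norm y) < 1" using y R by simp
    then obtain R' where "max R (norm y) < R'" "R' < 1" using dense by blast
    then have "\<exists>!v. v \<in> ball 0 R' \<and> v * P v = w" using R by (intro unique) auto
    moreover have "y \<in> ball 0 R'" "z \<in> ball 0 R'" using z \<open>max R (norm y) < R'\<close> by auto
    ultimately show "y = z" using y z by blast
  qed
qed

lemma one_le_of_growth_bound:
  fixes a y :: real
  assumes "0 \<le> a" "norm z < 1" and "1 + a * (1 - norm z) / (1 + norm z) \<le> y"
  shows "1 \<le> y"
proof -
  have "0 \<le> a * (1 - norm z) / (1 + norm z)" using assms by simp
  with assms(3) show ?thesis by linarith
qed

lemma nonlinear_resolvent_eqI:
  assumes eq: "\<And>z. z \<in> ball 0 1 \<Longrightarrow> z + of_real r * f z = z * P z"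
    and ex1: "\<exists>!z. z \<in> ball 0 1 \<and> z * P z = w"
    and z: "z \<in> ball 0 1" "z * P z = w"
  shows "nonlinear_resolvent f r w = z"
  unfolding nonlinear_resolvent_def
proof (rule the_equality)
  show "z \<in> ball 0 1 \<and> z + of_real r * f z = w" using z eq by simp
  show "y = z" if "y \<in> ball 0 1 \<and> y + of_real r * f y = w" for y
    using that eq[of y] ex1 z by auto
qed

section \<open>The radii\<close>

text \<open>The lower bound \<open>h s = s (1 + a (1 - s) / (1 + s))\<close> for \<open>|z P z|\<close> on \<open>|z| = s\<close> has the derivative
  \<open>1 - a + 2 a / (1 + s)\<^sup>2\<close>.  Its critical point, where \<open>h\<close> is largest, is the radius considered
  here; for \<open>a > 2\<close> it lies between \<open>sqrt 2 - 1\<close> and \<open>1\<close>.\<close>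

lemma extremal_radius:
  fixes a :: real
  assumes a: "a > 2"
  defines "s \<equiv> sqrt (2 * a / (a - 1)) - 1"
  shows "sqrt 2 - 1 < s" "s < 1"
    and "s * (1 + a * (1 - s) / (1 + s)) = (sqrt (2 * a) - sqrt (a - 1))\<^sup>2"
proof -
  define u v where "u = sqrt (2 * a)" and "v = sqrt (a - 1)"
  have uv: "u\<^sup>2 = 2 * a" "v\<^sup>2 = a - 1" "0 < u" "0 < v"
    using a by (auto simp: u_def v_def)
  have s: "s = u / v - 1" by (simp add: s_def u_def v_def real_sqrt_divide)
  have "2 < 2 * a / (a - 1)" using a by (simp add: field_simps)
  then show "sqrt 2 - 1 < s" unfolding s_def by (simp del: real_sqrt_divide)
  have "2 * a / (a - 1) < 2\<^sup>2" using a by (simp add: field_simps)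
  then have "sqrt (2 * a / (a - 1)) < 2" using real_sqrt_less_mono by fastforce
  then show "s < 1" by (simp add: s_def)
  have "s * (1 + a * (1 - s) / (1 + s)) = (u - v) / v * (1 + a * (2 * v - u) / u)"
    using uv by (simp add: s field_simps)
  also have "1 + a * (2 * v - u) / u = v * (u - v)"
  proof -
    have "a / u = u / 2" using uv by (simp add: field_simps power2_eq_square)
    then have "a * (2 * v - u) / u = u / 2 * (2 * v - u)" by (metis times_divide_eq_left)
    also have "\<dots> = u * v - a" using uv by (simp add: algebra_simps power2_eq_square)
    finally show ?thesis using uv by (simp add: algebra_simps power2_eq_square)
  qed
  finally show "s * (1 + a * (1 - s) / (1 + s)) = (sqrt (2 * a) - sqrt (a - 1))\<^sup>2"
    using uv by (simp add: u_def v_def power2_eq_square)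
qed

text \<open>The square equals \<open>3 a - 1 - 2 sqrt (2 a (a - 1))\<close>, so isolating the root and squaring reduces the two bounds
  to \<open>(a - 2)\<^sup>2 > 0\<close> and \<open>(a - 2) (7 a + 2) \<ge> 0\<close>.  The second one leaves room in the covering estimate
  for the extended resolvent.\<close>

lemma extremal_value_bounds:
  fixes a :: real
  assumes a: "a > 2"
  shows "1 < (sqrt (2 * a) - sqrt (a - 1))\<^sup>2" "(sqrt (2 * a) - sqrt (a - 1))\<^sup>2 \<le> a / 2"
proof -
  define u where "u = 2 * sqrt (2 * a * (a - 1))"
  have "0 \<le> 2 * a * (a - 1)" using a by simp
  then have u: "0 \<le> u" "u\<^sup>2 = 8 * a * (a - 1)"
    unfolding u_def power_mult_distrib by (simp_all only: real_sqrt_pow2) auto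
  have eq: "(sqrt (2 * a) - sqrt (a - 1))\<^sup>2 = 3 * a - 1 - u"
    using a by (simp add: u_def power2_diff real_sqrt_mult power_mult_distrib)
  have "0 < (a - 2)\<^sup>2" using a by simp
  then have "u\<^sup>2 < (3 * a - 2)\<^sup>2"
    unfolding u by (simp add: power2_eq_square algebra_simps)
  then have "u < 3 * a - 2" by (rule power2_less_imp_less) (use a in simp)
  then show "1 < (sqrt (2 * a) - sqrt (a - 1))\<^sup>2" by (simp add: eq)
  have "0 \<le> (a - 2) * (7 * a + 2)" using a by simp
  then have "(5 * a / 2 - 1)\<^sup>2 \<le> u\<^sup>2"
    unfolding u by (simp add: power2_eq_square field_simps)
  then have "5 * a / 2 - 1 \<le> u" by (rule power2_le_imp_le) (rule u)
  then show "(sqrt (2 * a) - sqrt (a - 1))\<^sup>2 \<le> a / 2" by (simp add: eq)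
qed

text \<open>After clearing denominators the hypothesis factors as \<open>(1 - s) (1 - (a - 1) s) > 0\<close>, so that even
  \<open>s < 1 / (a - 1)\<close>.\<close>

lemma growth_below_one_imp_small:
  fixes a s :: real
  assumes a: "a > 2" and s: "0 \<le> s" "s < 1" and less: "s * (1 + a * (1 - s) / (1 + s)) < 1"
  shows "s < 3 / (1 + a)"
proof -
  have "s * (1 + s + a * (1 - s)) < 1 + s"
    using less s by (simp add: field_simps)
  then have "0 < (1 - s) * (1 - (a - 1) * s)"
    by (simp add: algebra_simps)
  then have "(a - 1) * s < 1" using s by (simp add: zero_less_mult_iff)
  then have "s < 1 / (a - 1)" using a by (simp add: field_simps)
  also have "\<dots> < 3 / (1 + a)" using a by (simp add: field_simps)
  finally show ?thesis .
qed

text \<open>Since \<open>s (x + y) < \<rho>\<close> for \<open>y = sqrt (x\<^sup>2 + 1 - a)\<close>, it is enough that the term \<open>2 a s / (1 - s)\<close> is at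
  most \<open>y\<close>.  This has ample room: \<open>y \<ge> a\<close>, and \<open>3 \<rho> \<le> 3 a / 2 \<le> x + y\<close> gives \<open>s \<le> 1 / 3\<close>.\<close>

lemma covering_radius_extended:
  fixes a x \<rho> s :: real
  assumes a: "a > 2" and \<rho>: "\<rho> \<le> a / 2" and x: "1 + a \<le> x"
    and s: "0 \<le> s" "s < \<rho> / (x + sqrt (x\<^sup>2 + 1 - a))"
  shows "s < 1 / 4" "s * (x + 2 * a * s / (1 - s)) < \<rho>"
proof -
  define y where "y = sqrt (x\<^sup>2 + 1 - a)"
  have "(1 + a)\<^sup>2 \<le> x\<^sup>2" using a x by (intro power_mono) auto
  then have "a\<^sup>2 \<le> x\<^sup>2 + 1 - a" using a by (simp add: power2_eq_square algebra_simps)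
  then have y: "a \<le> y" unfolding y_def by (rule real_le_rsqrt)
  have s_less: "s * (x + y) < \<rho>" using s a x y by (simp add: y_def pos_less_divide_eq)
  have "s * (2 * a) \<le> s * (x + y)" using s x y by (intro mult_left_mono) auto
  with s_less \<rho> have "s * (2 * a) < a / 2" by linarith
  then show "s < 1 / 4" using a by (simp add: field_simps)
  have "s * (3 * y) \<le> y"
  proof -
    have "s * 3 * (x + y) \<le> 3 * \<rho>" using s_less by simp
    also have "\<dots> \<le> x + y" using \<rho> x y a by simp
    finally have "s * 3 \<le> 1" using x y a by simp
    then have "s * 3 * y \<le> 1 * y" using y a by (intro mult_right_mono) auto
    then show ?thesis by (simp add: mult_ac)
  qed
  moreover have "s * (2 * a) \<le> s * (2 * y)" using s y by (intro mult_left_mono) auto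
  ultimately have "2 * a * s \<le> y * (1 - s)" by (simp add: algebra_simps)
  then have "2 * a * s / (1 - s) \<le> y" using \<open>s < 1 / 4\<close> by (simp add: pos_divide_le_eq)
  then have "s * (x + 2 * a * s / (1 - s)) \<le> s * (x + y)" using s by (intro mult_left_mono) auto
  with s_less show "s * (x + 2 * a * s / (1 - s)) < \<rho>" by linarith
qed

text \<open>The assumption \<open>2 a \<le> x\<^sup>2 - 1\<close> turns the bound on \<open>|P z|\<close> into \<open>(x - s) / (1 - x s)\<close>, the bound of
  Schwarz and Pick for functions with \<open>|P| > 1\<close>.  Then \<open>s (x - s) < 1 - x s\<close> reads \<open>s\<^sup>2 - 2 x s + 1 > 0\<close>,
  and the smaller root of this quadratic is \<open>x - sqrt (x\<^sup>2 - 1) = 1 / (x + sqrt (x\<^sup>2 - 1))\<close>.\<close>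

lemma covering_radius_unit_disk:
  fixes a x s :: real
  assumes a: "0 < a" and x: "1 < x" "2 * a \<le> x\<^sup>2 - 1"
    and s: "0 \<le> s" "s < 1 / (x + sqrt (x\<^sup>2 - 1))"
  shows "s < 1" "s * (x + 2 * a * s / (1 - s)) < 1"
proof -
  define y where "y = sqrt (x\<^sup>2 - 1)"
  have y2: "y\<^sup>2 = x\<^sup>2 - 1" using x by (simp add: y_def)
  have y: "0 < y" "y < x"
    using x by (auto simp: y_def intro!: real_less_lsqrt)
  have "s < 1 / (x + y)" using s by (simp add: y_def)
  moreover have "0 < x + y" using x y by linarith
  ultimately have sxy: "s * (x + y) < 1" by (simp only: pos_less_divide_eq)
  then have sx: "s * x < 1" using s y by (smt (verit) mult_left_mono)
  then show s1: "s < 1" using s x by (smt (verit) mult_left_mono mult_cancel_left2)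
  have "(x + y) * (x - y) = 1" using y2 by (simp add: power2_eq_square algebra_simps)
  then have "s < x - y"
    using sxy y x by (metis add_pos_pos less_trans mult.commute mult_less_cancel_left_pos y(1) zero_less_one)
  then have "0 < (x - y - s) * (x + y - s)"
    using y by (intro mult_pos_pos) auto
  then have quad: "s * (x - s) < 1 - x * s"
    using y2 by (simp add: power2_eq_square algebra_simps)
  have "2 * a * s / (1 - s) \<le> (x\<^sup>2 - 1) * s / (1 - x * s)"
  proof (rule frac_le)
    show "2 * a * s \<le> (x\<^sup>2 - 1) * s" using x s by (intro mult_right_mono) auto
    show "1 - x * s \<le> 1 - s" using s x by (simp add: mult_le_cancel_right1)
  qed (use sx s a x in \<open>auto simp: mult.commute\<close>)
  then have "x + 2 * a * s / (1 - s) \<le> (x - s) / (1 - x * s)"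
    using sx by (simp add: field_simps power2_eq_square)
  then have "s * (x + 2 * a * s / (1 - s)) \<le> s * ((x - s) / (1 - x * s))"
    using s by (intro mult_left_mono) auto
  also have "\<dots> < 1" using quad sx by (simp add: field_simps)
  finally show "s * (x + 2 * a * s / (1 - s)) < 1" .
qed

section \<open>Extension and covering properties of the resolvent\<close>

text \<open>On the critical circle \<open>|z| = s\<^sub>0\<close> one has \<open>|z P z| \<ge> \<rho>\<close>, so every \<open>w\<close> in the disk of radius \<open>\<rho>\<close> has exactly
  one preimage inside that circle.  The extension is this inverse branch of \<open>z P z\<close>.\<close>

lemma resolvent_extension:
  assumes holP: "P holomorphic_on ball 0 1"
    and a: "a > 2"
    and low: "\<And>z. z \<in> ball 0 1 \<Longrightarrow> 1 + a * (1 - norm z) / (1 + norm z) \<le> norm (P z)"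
  defines "s\<^sub>0 \<equiv> sqrt (2 * a / (a - 1)) - 1" and "\<rho> \<equiv> (sqrt (2 * a) - sqrt (a - 1))\<^sup>2"
  obtains F where "univalent_on F (ball 0 \<rho>)"
    and "\<And>w. w \<in> ball 0 \<rho> \<Longrightarrow> F w \<in> ball 0 s\<^sub>0 \<and> F w * P (F w) = w"
    and "\<And>z. z \<in> ball 0 s\<^sub>0 \<Longrightarrow> z * P z \<in> ball 0 \<rho> \<Longrightarrow> F (z * P z) = z"
proof -
  let ?g = "\<lambda>z. z * P z"
  have "sqrt 2 - 1 < s\<^sub>0" and s1: "s\<^sub>0 < 1" and \<rho>_eq: "s\<^sub>0 * (1 + a * (1 - s\<^sub>0) / (1 + s\<^sub>0)) = \<rho>"
    using extremal_radius [OF a] unfolding s\<^sub>0_def \<rho>_def by auto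
  moreover have "1 < sqrt (2::real)" by simp
  ultimately have s0: "0 < s\<^sub>0" by linarith
  have sub: "ball 0 s\<^sub>0 \<subseteq> (ball 0 1 :: complex set)" using s1 by auto
  have ex1: "\<exists>!z. z \<in> ball 0 s\<^sub>0 \<and> ?g z = w" if w: "w \<in> ball 0 \<rho>" for w
  proof (rule unique_preimage_in_disk [OF holP _ s0 s1])
    fix z :: complex
    show "P z \<noteq> 0" if z: "z \<in> ball 0 1"
      using one_le_of_growth_bound [OF _ _ low[OF z]] z a by auto
    show "norm w < norm (?g z)" if z: "norm z = s\<^sub>0"
    proof -
      have "\<rho> \<le> s\<^sub>0 * norm (P z)"
        unfolding \<rho>_eq [symmetric] using low[of z] z s0 s1 by (intro mult_left_mono) auto
      then show ?thesis using w z by (simp add: norm_mult)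
    qed
  qed
  define U where "U = {z \<in> ball 0 s\<^sub>0. ?g z \<in> ball 0 \<rho>}"
  have holg: "?g holomorphic_on ball 0 s\<^sub>0"
    by (intro holomorphic_intros holomorphic_on_subset [OF holP sub])
  have "open (ball 0 s\<^sub>0 \<inter> ?g -` ball 0 \<rho>)"
    by (rule continuous_open_preimage [OF holomorphic_on_imp_continuous_on [OF holg] open_ball open_ball])
  then have "open U"
    by (rule back_subst [of "open"]) (auto simp: U_def)
  have inj: "inj_on ?g U"
    using ex1 by (intro inj_onI) (auto simp: U_def simp del: mem_ball)
  have image: "?g ` U = ball 0 \<rho>"
  proof
    show "?g ` U \<subseteq> ball 0 \<rho>" by (auto simp: U_def)
    show "ball 0 \<rho> \<subseteq> ?g ` U"
    proof
      fix w :: complex assume w: "w \<in> ball 0 \<rho>"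
      then obtain z where "z \<in> ball 0 s\<^sub>0" "?g z = w" using ex1 by blast
      with w show "w \<in> ?g ` U" by (intro image_eqI [of _ _ z]) (auto simp: U_def)
    qed
  qed
  have "?g holomorphic_on U"
    by (rule holomorphic_on_subset [OF holg]) (auto simp: U_def)
  then obtain F where F: "F holomorphic_on ?g ` U" "\<And>z. z \<in> U \<Longrightarrow> F (?g z) = z"
    using holomorphic_has_inverse [OF _ \<open>open U\<close> inj] by metis
  have FU: "F w \<in> U \<and> ?g (F w) = w" if "w \<in> ball 0 \<rho>" for w
    using that F(2) unfolding image [symmetric] by auto
  show ?thesis
  proof
    show "univalent_on F (ball 0 \<rho>)"
      unfolding univalent_on_def
    proof
      show "F holomorphic_on ball 0 \<rho>" using F(1) by (simp only: image)
      show "inj_on F (ball 0 \<rho>)" using FU by (intro inj_on_inverseI [where g = "?g"]) blast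
    qed
    show "F w \<in> ball 0 s\<^sub>0 \<and> F w * P (F w) = w" if "w \<in> ball 0 \<rho>" for w
      using FU[OF that] by (simp add: U_def)
    show "F (?g z) = z" if "z \<in> ball 0 s\<^sub>0" "?g z \<in> ball 0 \<rho>" for z
      using that by (intro F) (simp add: U_def)
  qed
qed

lemma cmod_one_plus_sq:
  "(cmod (1 + of_real r * q))\<^sup>2 = 1 + 2 * (r * Re q) + r\<^sup>2 * (cmod q)\<^sup>2"
  unfolding cmod_power2 by (simp add: power2_eq_square algebra_simps)

theorem theorem3p2:
  fixes q :: complex
  assumes "Re q > 0"
  shows "(\<forall>r::real. r > 2 / Re q \<longrightarrow>
            rho q r > 1 \<and>
            (\<forall>G\<in>resolvent_family q r.
               (\<exists>F. univalent_on F (ball 0 (rho q r)) \<and>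
                    (\<forall>w\<in>ball 0 1. F w = G w) \<and>
                    F ` ball 0 (rho q r) \<subseteq> ball 0 (rho1 q r) \<and>
                    ball 0 (rho2 q r) \<subseteq> F ` ball 0 (rho q r)) \<and>
               G ` ball 0 1 \<subseteq> ball 0 (rho3 q r))) \<and>
         (\<forall>r::real. r > 0 \<longrightarrow>
            (\<forall>G\<in>resolvent_family q r. ball 0 (rho4 q r) \<subseteq> G ` ball 0 1))"
proof (intro conjI allI impI ballI)
  fix r :: real
  assume r: "r > 2 / Re q"
  define a where "a = r * Re q"
  define x where "x = cmod (1 + of_real r * q)"
  have a: "a > 2" using r assms by (simp add: a_def field_simps)
  have r0: "r > 0" using r assms by (smt (verit) divide_pos_pos)
  have rho: "rho q r = (sqrt (2 * a) - sqrt (a - 1))\<^sup>2" by (simp add: rho_def a_def mult.assoc)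
  have rho1: "rho1 q r = sqrt (2 * a / (a - 1)) - 1" by (simp add: rho1_def a_def mult.assoc)
  have "2 + r * Re q + r\<^sup>2 * (cmod q)\<^sup>2 = x\<^sup>2 + 1 - a"
    unfolding x_def cmod_one_plus_sq by (simp add: a_def)
  then have rho2: "rho2 q r = rho q r / (x + sqrt (x\<^sup>2 + 1 - a))"
    by (simp add: rho2_def rho_def x_def)
  show rho_gt: "rho q r > 1" unfolding rho by (rule extremal_value_bounds(1) [OF a])
  have rho_le: "rho q r \<le> a / 2" unfolding rho by (rule extremal_value_bounds(2) [OF a])
  have "Re (1 + of_real r * q) \<le> x" unfolding x_def by (rule complex_Re_le_cmod)
  then have x: "1 + a \<le> x" by (simp add: a_def)
  fix G assume "G \<in> resolvent_family q r"
  then obtain f where f: "generator f" "f 0 = 0" "deriv f 0 = q" and G: "G = nonlinear_resolvent f r"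
    by (auto simp: resolvent_family_def)
  obtain P where P: "P holomorphic_on ball 0 1" "\<And>z. z \<in> ball 0 1 \<Longrightarrow> z + of_real r * f z = z * P z"
    and low: "\<And>z. z \<in> ball 0 1 \<Longrightarrow> 1 + a * (1 - norm z) / (1 + norm z) \<le> norm (P z)"
    and up: "\<And>z. z \<in> ball 0 1 \<Longrightarrow> norm (P z) \<le> x + 2 * a * norm z / (1 - norm z)"
    using resolvent_equation_factor [OF f(1,2) _ r0] assms unfolding f(3) a_def x_def by metis
  have P_ge: "1 \<le> norm (P z)" if "z \<in> ball 0 1" for z
    using low[OF that] that a by (intro one_le_of_growth_bound [of a z]) auto
  note ex1 = unique_preimage_in_unit_disk [OF P(1) P_ge]
  note G_eq = nonlinear_resolvent_eqI [OF P(2) ex1, folded G]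
  have rho1_bounds: "1 / 4 < rho1 q r" "rho1 q r < 1"
  proof -
    have "5 / 4 < sqrt (2::real)" by (rule real_less_rsqrt) (simp add: power2_eq_square)
    then show "1 / 4 < rho1 q r" "rho1 q r < 1" using extremal_radius [OF a] unfolding rho1 by linarith+
  qed
  obtain F where F: "univalent_on F (ball 0 (rho q r))"
    and F_in: "\<And>w. w \<in> ball 0 (rho q r) \<Longrightarrow> F w \<in> ball 0 (rho1 q r) \<and> F w * P (F w) = w"
    and F_inv: "\<And>z. z \<in> ball 0 (rho1 q r) \<Longrightarrow> z * P z \<in> ball 0 (rho q r) \<Longrightarrow> F (z * P z) = z"
    using resolvent_extension [OF P(1) a low] unfolding rho [symmetric] rho1 [symmetric] by metis
  have FG: "F w = G w" if w: "w \<in> ball 0 1" for w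
    using F_in[of w] w rho_gt rho1_bounds by (intro G_eq [symmetric]) auto
  show "\<exists>F. univalent_on F (ball 0 (rho q r)) \<and>
            (\<forall>w\<in>ball 0 1. F w = G w) \<and>
            F ` ball 0 (rho q r) \<subseteq> ball 0 (rho1 q r) \<and>
            ball 0 (rho2 q r) \<subseteq> F ` ball 0 (rho q r)"
  proof (intro exI [of _ F] conjI ballI)
    show "F ` ball 0 (rho q r) \<subseteq> ball 0 (rho1 q r)" using F_in by blast
    show "ball 0 (rho2 q r) \<subseteq> F ` ball 0 (rho q r)"
    proof
      fix z :: complex assume z: "z \<in> ball 0 (rho2 q r)"
      have "norm z < rho q r / (x + sqrt (x\<^sup>2 + 1 - a))"
        using z by (simp add: rho2)
      note cov = covering_radius_extended [OF a rho_le x norm_ge_zero this]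
      have "norm (z * P z) \<le> norm z * (x + 2 * a * norm z / (1 - norm z))"
        unfolding norm_mult using cov(1) by (intro mult_left_mono up) auto
      also note cov(2)
      finally have "z * P z \<in> ball 0 (rho q r)" by simp
      moreover from this have "F (z * P z) = z" using cov(1) rho1_bounds by (intro F_inv) auto
      ultimately show "z \<in> F ` ball 0 (rho q r)" by (metis imageI)
    qed
  qed (use F FG in auto)
  show "G ` ball 0 1 \<subseteq> ball 0 (rho3 q r)"
  proof
    fix z assume "z \<in> G ` ball 0 1"
    then obtain w where w: "w \<in> ball 0 1" "z = F w" using FG by auto
    have "w \<in> ball 0 (rho q r)" using w rho_gt by auto
    from F_in[OF this] have z: "z \<in> ball 0 1" "z * P z = w" using w rho1_bounds by auto
    have "norm z * (1 + a * (1 - norm z) / (1 + norm z)) \<le> norm (z * P z)"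
      unfolding norm_mult by (intro mult_left_mono low z) auto
    also have "\<dots> < 1" using z w by simp
    finally have "norm z < 3 / (1 + a)"
      using z by (intro growth_below_one_imp_small [OF a]) auto
    then show "z \<in> ball 0 (rho3 q r)" by (simp add: rho3_def a_def)
  qed
next
  fix r :: real and G :: "complex \<Rightarrow> complex"
  assume r: "r > 0" and "G \<in> resolvent_family q r"
  then obtain f where f: "generator f" "f 0 = 0" "deriv f 0 = q" and G: "G = nonlinear_resolvent f r"
    by (auto simp: resolvent_family_def)
  define a where "a = r * Re q"
  define x where "x = cmod (1 + of_real r * q)"
  have a: "a > 0" using r assms by (simp add: a_def)
  have "Re (1 + of_real r * q) \<le> x" unfolding x_def by (rule complex_Re_le_cmod)
  then have x: "1 < x" using a by (simp add: a_def)
  have x2: "2 * a \<le> x\<^sup>2 - 1" unfolding x_def cmod_one_plus_sq by (simp add: a_def)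
  obtain P where P: "P holomorphic_on ball 0 1" "\<And>z. z \<in> ball 0 1 \<Longrightarrow> z + of_real r * f z = z * P z"
    and low: "\<And>z. z \<in> ball 0 1 \<Longrightarrow> 1 + a * (1 - norm z) / (1 + norm z) \<le> norm (P z)"
    and up: "\<And>z. z \<in> ball 0 1 \<Longrightarrow> norm (P z) \<le> x + 2 * a * norm z / (1 - norm z)"
    using resolvent_equation_factor [OF f(1,2) _ r] assms unfolding f(3) a_def x_def by metis
  have P_ge: "1 \<le> norm (P z)" if "z \<in> ball 0 1" for z
    using low[OF that] that a by (intro one_le_of_growth_bound [of a z]) auto
  note G_eq = nonlinear_resolvent_eqI [OF P(2) unique_preimage_in_unit_disk [OF P(1) P_ge], folded G]
  show "ball 0 (rho4 q r) \<subseteq> G ` ball 0 1"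
  proof
    fix z :: complex assume "z \<in> ball 0 (rho4 q r)"
    then have "norm z < 1 / (x + sqrt (x\<^sup>2 - 1))" by (simp add: rho4_def x_def)
    note cov = covering_radius_unit_disk [OF a x x2 norm_ge_zero this]
    have "norm (z * P z) \<le> norm z * (x + 2 * a * norm z / (1 - norm z))"
      unfolding norm_mult using cov(1) by (intro mult_left_mono up) auto
    also note cov(2)
    finally have "z * P z \<in> ball 0 1" by simp
    moreover from this have "G (z * P z) = z" using cov(1) by (intro G_eq) auto
    ultimately show "z \<in> G ` ball 0 1" by (metis imageI)
  qed
qed

end
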